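(* Let $(\Omega,\mathcal{F},\mathbb{P})$ be a probability space, let $\mathcal{X}\subseteq\mathbb{L}^0_+$, and for each $n\in\mathbb{N}$ define $$\mathcal{O}^{\mathcal{X}}_n:=\{Y\in\mathbb{L}^0_+ : Y\le Z \text{ for some } Z\in\mathrm{conv}\{(X-n)_+ : X\in\mathcal{X}\}\}.$$ Then the following are equivalent: (1) $\bigcap_{n\in\mathbb{N}}\mathcal{O}^{\mathcal{X}}_n=\{0\}$; (2) there exists a probability $\mathbb{Q}$ equivalent to $\mathbb{P}$ such that $\mathcal{X}$ is uniformly $\mathbb{Q}$-integrable, i.e. $\lim_{n\to\infty}\sup_{X\in\mathcal{X}}\mathbb{E}_{\mathbb{Q}}[X\mathbb{I}_{\{X>n\}}]=0$.
   Context: $\mathbb{L}^0$ is the space of (equivalence classes modulo $\mathbb{P}$-null sets of) real-valued random variables, $\mathbb{L}^0_+$ its nonnegative elements; inequalities are $\mathbb{P}$-a.s. $\mathrm{conv}$ denotes the convex hull (finite convex combinations), and $x_+=\max\{x,0\}$. *)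

theory Defs
  imports "HOL-Probability.Probability"
begin

definition L0_plus :: "'a measure \<Rightarrow> ('a \<Rightarrow> real) set" where
  "L0_plus M = {Y. Y \<in> borel_measurable M \<and> (AE \<omega> in M. 0 \<le> Y \<omega>)}"

definition conv_shift :: "('a \<Rightarrow> real) set \<Rightarrow> nat \<Rightarrow> ('a \<Rightarrow> real) set" where
  "conv_shift \<X> n = {Z. \<exists>(k::nat) (c::nat \<Rightarrow> real) (F::nat \<Rightarrow> 'a \<Rightarrow> real).
      (\<forall>i<k. 0 \<le> c i) \<and> (\<Sum>i<k. c i) = 1 \<and> (\<forall>i<k. F i \<in> \<X>) \<and>
      Z = (\<lambda>\<omega>. \<Sum>i<k. c i * max (F i \<omega> - real n) 0)}"

definition O_set :: "'a measure \<Rightarrow> ('a \<Rightarrow> real) set \<Rightarrow> nat \<Rightarrow> ('a \<Rightarrow> real) set" where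
  "O_set M \<X> n = {Y \<in> L0_plus M. \<exists>Z \<in> conv_shift \<X> n. AE \<omega> in M. Y \<omega> \<le> Z \<omega>}"

definition equiv_prob :: "'a measure \<Rightarrow> 'a measure \<Rightarrow> bool" where
  "equiv_prob M Q \<longleftrightarrow> prob_space Q \<and> sets Q = sets M \<and> space Q = space M \<and>
     (\<forall>A \<in> sets M. emeasure Q A = 0 \<longleftrightarrow> emeasure M A = 0)"

definition unif_integrable :: "'a measure \<Rightarrow> ('a \<Rightarrow> real) set \<Rightarrow> bool" where
  "unif_integrable Q \<X> \<longleftrightarrow>
     ((\<lambda>n::nat. SUP X\<in>\<X>. \<integral>\<^sup>+ \<omega>. ennreal (X \<omega> * indicator {\<omega>. X \<omega> > real n} \<omega>) \<partial>Q)
        \<longlonglongrightarrow> 0)"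

end

theory Submission
  imports Defs
begin

text \<open>For the substantial direction, put \<open>u(x) = x / (1 + x)\<close> and \<open>v(x) = 1 - u(x) = 1 / (1 + x)\<close>.
  The functional \<open>f \<mapsto> E[u(f)]\<close> is bounded and uniformly concave, so near maximisers over a decreasing
  sequence of convex sets \<open>D\<^sub>n\<close> can be chosen as \<open>f\<^sub>n \<in> D\<^sub>n\<close> with \<open>\<Sum>\<^sub>n E\<bar>v(f\<^sub>n) - v(f\<^sub>n\<^sub>+\<^sub>1)\<bar>\<close> as small
  as desired. This is used twice. If \<open>E[u]\<close> does not become uniformly small on \<open>D\<^sub>n\<close>, the positive
  part of \<open>u(f\<^sub>0) - \<Sum>\<^sub>n \<bar>v(f\<^sub>n) - v(f\<^sub>n\<^sub>+\<^sub>1)\<bar>\<close> is nonzero and lies below an element of every \<open>D\<^sub>n\<close>. And for a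
  single convex \<open>D\<close> on which \<open>E[u]\<close> is small, \<open>v(f\<^sub>n)\<^sup>2 = u'(f\<^sub>n)\<close> converges to a density \<open>g\<close>, close to
  \<open>1\<close>, with \<open>E[g f] \<le> 1\<close> on \<open>D\<close>. Applied to multiples of the convex hulls of \<open>(X - n)\<^sub>+\<close>, this yields
  densities \<open>g\<^sub>i \<rightarrow> 1\<close> and levels \<open>N\<^sub>i\<close> with \<open>E[g\<^sub>i (X - N\<^sub>i)\<^sub>+] \<le> 2\<^sup>-\<^sup>i\<close> uniformly in \<open>X\<close>; a weighted sum of
  the tail infima \<open>inf {g\<^sub>i | i \<ge> j}\<close> is, after normalisation, the density of \<open>Q\<close>.\<close>

section \<open>Convex sets of nonnegative functions and the saturated expectation\<close>

text \<open>Nonnegativity is required at every point rather than almost everywhere, so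
  \<open>1 + f x\<close> never vanishes and the estimates below hold pointwise. The positive parts
  in \<open>conv_shift\<close> meet this requirement.\<close>

definition nonneg_convex :: "'a measure \<Rightarrow> ('a \<Rightarrow> real) set \<Rightarrow> bool" where
  "nonneg_convex M D \<longleftrightarrow>
     (\<forall>f\<in>D. f \<in> borel_measurable M \<and> (\<forall>x. 0 \<le> f x)) \<and>
     (\<forall>f\<in>D. \<forall>g\<in>D. \<forall>t\<in>{0..1}. (\<lambda>x. (1 - t) * f x + t * g x) \<in> D)"

lemma nonneg_convexD:
  assumes "nonneg_convex M D" "f \<in> D"
  shows "f \<in> borel_measurable M" "0 \<le> f x"
  using assms by (auto simp: nonneg_convex_def)

lemma nonneg_convex_comb:
  assumes "nonneg_convex M D" "f \<in> D" "g \<in> D" "0 \<le> t" "t \<le> 1"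
  shows "(\<lambda>x. (1 - t) * f x + t * g x) \<in> D"
  using assms unfolding nonneg_convex_def by auto

text \<open>This is E[u(f)] for the bounded concave u of the overview. It is finite even when f has
  no expectation, and its smallness means that f is close to 0 in probability.\<close>

definition sat_integral :: "'a measure \<Rightarrow> ('a \<Rightarrow> real) \<Rightarrow> real" where
  "sat_integral M f = (\<integral>x. f x / (1 + f x) \<partial>M)"

lemma (in prob_space) integrable_bounded:
  fixes f :: "'a \<Rightarrow> real"
  assumes "f \<in> borel_measurable M" "\<And>x. \<bar>f x\<bar> \<le> B"
  shows "integrable M f"
  using assms by (intro integrable_const_bound[where B=B]) auto

lemma frac_unit_bounds:
  fixes x :: real
  assumes "0 \<le> x"
  shows "0 \<le> x / (1 + x)" "x / (1 + x) \<le> 1" "0 < 1 / (1 + x)" "1 / (1 + x) \<le> 1"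
    "x / (1 + x) = 1 - 1 / (1 + x)" "x / (1 + x) \<le> x"
  using assms by (auto simp: field_simps)

context prob_space
begin

lemma integrable_recip:
  assumes "nonneg_convex M D" "f \<in> D"
  shows "integrable M (\<lambda>x. 1 / (1 + f x))"
  using nonneg_convexD(1)[OF assms] frac_unit_bounds(3,4)[OF nonneg_convexD(2)[OF assms]]
  by (intro integrable_bounded[where B=1]) (auto simp: abs_of_pos)

lemma integrable_sat:
  assumes "nonneg_convex M D" "f \<in> D"
  shows "integrable M (\<lambda>x. f x / (1 + f x))"
  using integrable_recip[OF assms] by (simp add: frac_unit_bounds(5)[OF nonneg_convexD(2)[OF assms]])

lemma sat_integral_eq:
  assumes "nonneg_convex M D" "f \<in> D"
  shows "sat_integral M f = 1 - (\<integral>x. 1 / (1 + f x) \<partial>M)"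
proof -
  have "sat_integral M f = (\<integral>x. 1 - 1 / (1 + f x) \<partial>M)"
    unfolding sat_integral_def
    by (intro Bochner_Integration.integral_cong refl frac_unit_bounds(5) nonneg_convexD[OF assms])
  also have "\<dots> = 1 - (\<integral>x. 1 / (1 + f x) \<partial>M)"
    using integrable_recip[OF assms] by (simp add: prob_space)
  finally show ?thesis .
qed

lemma sat_integral_bounds:
  assumes "nonneg_convex M D" "f \<in> D"
  shows "0 \<le> sat_integral M f" "sat_integral M f \<le> 1"
proof -
  show "0 \<le> sat_integral M f"
    unfolding sat_integral_def
    by (intro Bochner_Integration.integral_nonneg frac_unit_bounds nonneg_convexD[OF assms])
  have "0 \<le> (\<integral>x. 1 / (1 + f x) \<partial>M)"
    by (intro Bochner_Integration.integral_nonneg less_imp_le frac_unit_bounds nonneg_convexD[OF assms])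
  then show "sat_integral M f \<le> 1"
    by (simp add: sat_integral_eq[OF assms])
qed

text \<open>With \<open>v = 1 / (1 + f)\<close>, passing to the midpoint replaces the arithmetic mean of two values
  of \<open>v\<close> by their harmonic mean, which is smaller by at least a quarter of the squared distance.\<close>
lemma sat_integral_midpoint_gap:
  assumes D: "nonneg_convex M D" and f: "f \<in> D" and g: "g \<in> D"
  shows "(\<integral>x. (1 / (1 + f x) - 1 / (1 + g x))\<^sup>2 \<partial>M)
    \<le> 4 * (sat_integral M (\<lambda>x. (1 - 1/2) * f x + 1/2 * g x)
           - (sat_integral M f + sat_integral M g) / 2)"
proof -
  let ?m = "\<lambda>x. (1 - 1/2) * f x + 1/2 * g x"
  have m: "?m \<in> D" by (rule nonneg_convex_comb[OF D f g]) auto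
  note int = integrable_recip[OF D f] integrable_recip[OF D g] integrable_recip[OF D m]
  note meas[measurable] = nonneg_convexD(1)[OF D f] nonneg_convexD(1)[OF D g]
  have pw: "(1 / (1 + f x) - 1 / (1 + g x))\<^sup>2
      \<le> 2 * (1 / (1 + f x)) + 2 * (1 / (1 + g x)) - 4 * (1 / (1 + ?m x))" for x
  proof -
    define a b where "a = 1 + f x" and "b = 1 + g x"
    have ab: "a \<ge> 1" "b \<ge> 1"
      using nonneg_convexD(2)[OF D f] nonneg_convexD(2)[OF D g] by (auto simp: a_def b_def)
    have m: "1 + ?m x = (a + b) / 2" by (simp add: a_def b_def field_simps)
    have "2 * (1 / a) + 2 * (1 / b) - 4 * (1 / ((a + b) / 2)) = 2 * (a - b)\<^sup>2 / (a * b * (a + b))"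
      using ab by (simp add: field_simps power2_eq_square)
    moreover have "(1 / a - 1 / b)\<^sup>2 = (a - b)\<^sup>2 / (a * b * (a * b))"
      using ab by (simp add: field_simps power2_eq_square)
    moreover have "(a - b)\<^sup>2 / (a * b * (a * b)) \<le> 2 * (a - b)\<^sup>2 / (a * b * (a + b))"
    proof -
      \<comment> \<open>Comparing the two denominators is where \<open>a, b \<ge> 1\<close> enters:
        the product dominates each factor.\<close>
      have "a + b \<le> 2 * (a * b)"
        using mult_left_mono[of 1 b a] mult_right_mono[of 1 a b] ab by linarith
      then have "(a - b)\<^sup>2 * (a + b) \<le> (a - b)\<^sup>2 * (2 * (a * b))"
        by (intro mult_left_mono) auto
      then show ?thesis using ab by (simp add: divide_simps)
    qed
    ultimately show ?thesis unfolding m a_def[symmetric] b_def[symmetric] by simp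
  qed
  have lin: "(\<integral>x. 2 * a x + 2 * b x - 4 * c x \<partial>M)
      = 2 * (\<integral>x. a x \<partial>M) + 2 * (\<integral>x. b x \<partial>M) - 4 * (\<integral>x. c x \<partial>M)"
    if "integrable M a" "integrable M b" "integrable M c" for a b c :: "'a \<Rightarrow> real"
    using that by simp
  have "integrable M (\<lambda>x. (1 / (1 + f x) - 1 / (1 + g x))\<^sup>2)"
  proof (rule integrable_bounded[where B=1])
    fix x
    have "\<bar>1 / (1 + f x) - 1 / (1 + g x)\<bar> \<le> 1"
      using frac_unit_bounds(3,4)[OF nonneg_convexD(2)[OF D f, of x]]
        frac_unit_bounds(3,4)[OF nonneg_convexD(2)[OF D g, of x]] by linarith
    then show "\<bar>(1 / (1 + f x) - 1 / (1 + g x))\<^sup>2\<bar> \<le> 1"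
      by (simp add: abs_square_le_1)
  qed simp
  then have "(\<integral>x. (1 / (1 + f x) - 1 / (1 + g x))\<^sup>2 \<partial>M)
     \<le> (\<integral>x. 2 * (1 / (1 + f x)) + 2 * (1 / (1 + g x)) - 4 * (1 / (1 + ?m x)) \<partial>M)"
    by (intro integral_mono pw Bochner_Integration.integrable_add Bochner_Integration.integrable_diff
        integrable_mult_right int)
  also have "\<dots> = 2 * (\<integral>x. 1 / (1 + f x) \<partial>M) + 2 * (\<integral>x. 1 / (1 + g x) \<partial>M)
      - 4 * (\<integral>x. 1 / (1 + ?m x) \<partial>M)"
    by (rule lin[OF int])
  finally show ?thesis
    unfolding sat_integral_eq[OF D f] sat_integral_eq[OF D g] sat_integral_eq[OF D m]
    by (simp add: field_simps)
qed

section \<open>Near maximisers over decreasing convex sets\<close>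

text \<open>The suprema over \<open>D n\<close> decrease to a limit \<open>l\<close>. If
  \<open>f i\<close> and \<open>f (Suc i)\<close> both nearly attain \<open>l\<close>, their
  midpoint cannot exceed \<open>l\<close> by much, so \<open>sat_integral_midpoint_gap\<close> makes
  their reciprocals close in L2, hence in L1.\<close>

lemma near_maximisers_Cauchy:
  assumes D: "\<And>n. nonneg_convex M (D n)" "\<And>n. D n \<noteq> {}" "decseq D" and \<eta>: "0 < \<eta>"
  obtains f where
    "\<And>i::nat. \<exists>n\<ge>i. f i \<in> D n \<and> (\<forall>h\<in>D n. sat_integral M h \<le> sat_integral M (f i) + (\<eta> / 2 ^ i)\<^sup>2)"
    "\<And>i. (\<integral>\<^sup>+x. ennreal \<bar>1 / (1 + f i x) - 1 / (1 + f (Suc i) x)\<bar> \<partial>M) \<le> ennreal (\<eta> / 2 ^ i)"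
proof -
  define s where "s n = (SUP f\<in>D n. sat_integral M f)" for n
  have bdd: "bdd_above (sat_integral M ` D n)" for n
    using sat_integral_bounds[OF D(1)] by (intro bdd_aboveI2[where M=1]) auto
  have le_s: "sat_integral M f \<le> s n" if "f \<in> D n" for f n
    unfolding s_def using bdd that by (intro cSUP_upper) auto
  have s0: "0 \<le> s n" for n
    using D(2)[of n] sat_integral_bounds(1)[OF D(1)] le_s by (meson all_not_in_conv order_trans)
  define l where "l = (INF n. s n)"
  have bdds: "bdd_below (range s)" using s0 by (intro bdd_belowI2[where m=0]) auto
  have l_le: "l \<le> s n" for n unfolding l_def using bdds by (intro cINF_lower) auto
  have decs: "s n \<le> s m" if "m \<le> n" for m n
    unfolding s_def using D that bdd by (intro cSUP_subset_mono) (auto dest: decseqD)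
  \<comment> \<open>The midpoint is at most \<open>l + e i\<close> and both endpoints are above
    \<open>l - e i\<close>, so the gap lemma yields at most \<open>8 * e i\<close>. Any divisor of
    at least 8 would serve.\<close>
  define e where "e i = (\<eta> / 2 ^ i)\<^sup>2 / 12" for i :: nat
  have e0: "0 < e i" for i using \<eta> by (simp add: e_def)
  have "\<exists>n\<ge>i. \<exists>f\<in>D n. s n < l + e i \<and> s n - e i < sat_integral M f" for i
  proof -
    have "\<exists>n. s n < l + e i"
      using cINF_less_iff[OF _ bdds, of "l + e i"] e0[of i] unfolding l_def by auto
    then obtain n where n: "s n < l + e i" by blast
    \<comment> \<open>The maximum enforces \<open>n \<ge> i\<close> without spoiling the supremum,
      which decreases in the index.\<close>
    let ?n = "max i n"
    have "s ?n < l + e i" using decs[of n ?n] n by simp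
    moreover have "\<exists>f\<in>D ?n. s ?n - e i < sat_integral M f"
      using less_cSUP_iff[OF D(2) bdd, of "s ?n - e i" ?n] e0[of i] unfolding s_def by auto
    ultimately show ?thesis by (intro exI[of _ ?n]) auto
  qed
  then obtain r f where r: "\<And>i. i \<le> r i" and f: "\<And>i. f i \<in> D (r i)"
    and sr: "\<And>i. s (r i) < l + e i" and sf: "\<And>i. s (r i) - e i < sat_integral M (f i)"
    by metis
  show thesis
  proof (rule that[of f])
    fix i
    have "sat_integral M h \<le> sat_integral M (f i) + (\<eta> / 2 ^ i)\<^sup>2" if "h \<in> D (r i)" for h
    proof -
      have "e i \<le> (\<eta> / 2 ^ i)\<^sup>2" by (simp add: e_def)
      then show ?thesis using le_s[OF that] sf[of i] by linarith
    qed
    then show "\<exists>n\<ge>i. f i \<in> D n \<and> (\<forall>h\<in>D n. sat_integral M h \<le> sat_integral M (f i) + (\<eta> / 2 ^ i)\<^sup>2)"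
      using r f by blast
    \<comment> \<open>The indices \<open>r i\<close> need not increase with i. The smaller one gives
      the larger set, which contains both functions and hence their midpoint.\<close>
    define k where "k = min (r i) (r (Suc i))"
    have fk: "f i \<in> D k" "f (Suc i) \<in> D k"
      using f decseqD[OF D(3), of k "r i"] decseqD[OF D(3), of k "r (Suc i)"]
      unfolding k_def by (auto simp: subset_eq)
    have e_Suc: "e (Suc i) \<le> e i"
      using \<eta> unfolding e_def by (intro divide_right_mono power_mono divide_left_mono) auto
    have sk: "s k \<le> l + e i"
      using sr[of i] sr[of "Suc i"] e_Suc unfolding k_def min_def by (auto split: if_splits)
    let ?d = "\<lambda>x. 1 / (1 + f i x) - 1 / (1 + f (Suc i) x)"
    let ?L = "\<eta> / 2 ^ i"
    have L: "0 < ?L" using \<eta> by simp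
    have "sat_integral M (\<lambda>x. (1 - 1/2) * f i x + 1/2 * f (Suc i) x) \<le> l + e i"
      using le_s[OF nonneg_convex_comb[OF D(1) fk, of "1/2"]] sk by simp
    then have "(\<integral>x. (?d x)\<^sup>2 \<partial>M) \<le> 8 * e i"
      using sat_integral_midpoint_gap[OF D(1) fk] sf[of i] sf[of "Suc i"] l_le[of "r i"]
        l_le[of "r (Suc i)"] e_Suc by argo
    also have "\<dots> \<le> ?L\<^sup>2" by (simp add: e_def)
    finally have sq: "(\<integral>x. (?d x)\<^sup>2 \<partial>M) \<le> ?L\<^sup>2" .
    have meas[measurable]: "f i \<in> borel_measurable M" "f (Suc i) \<in> borel_measurable M"
      using nonneg_convexD(1)[OF D(1)] f by blast+
    have d1: "\<bar>?d x\<bar> \<le> 1" for x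
      using frac_unit_bounds(3,4)[OF nonneg_convexD(2)[OF D(1) fk(1), of x]]
        frac_unit_bounds(3,4)[OF nonneg_convexD(2)[OF D(1) fk(2), of x]] by linarith
    have int: "integrable M (\<lambda>x. \<bar>?d x\<bar>)" "integrable M (\<lambda>x. (?d x)\<^sup>2)"
      using d1 by (auto intro!: integrable_bounded[where B=1] simp: abs_square_le_1)
    \<comment> \<open>Young's inequality with weight \<open>L\<close> replaces Cauchy-Schwarz: an L2
      bound \<open>L\<^sup>2\<close> gives the L1 bound \<open>L/2 + L/2\<close>.\<close>
    have amgm: "\<bar>d\<bar> \<le> d\<^sup>2 / (2 * L) + L / 2" if "0 < L" for d L :: real
    proof -
      have "0 \<le> (\<bar>d\<bar> - L)\<^sup>2" by simp
      then have "2 * \<bar>d\<bar> * L \<le> d\<^sup>2 + L\<^sup>2" by (simp add: power2_diff)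
      then have "\<bar>d\<bar> \<le> (d\<^sup>2 + L\<^sup>2) / (2 * L)"
        using that by (subst pos_le_divide_eq) (auto simp: mult_ac)
      also have "\<dots> = d\<^sup>2 / (2 * L) + L / 2"
        using that by (simp add: add_divide_distrib power2_eq_square)
      finally show ?thesis .
    qed
    have "(\<integral>x. \<bar>?d x\<bar> \<partial>M) \<le> (\<integral>x. (?d x)\<^sup>2 / (2 * ?L) + ?L / 2 \<partial>M)"
      using int by (intro integral_mono amgm L) auto
    also have "\<dots> = (\<integral>x. (?d x)\<^sup>2 \<partial>M) / (2 * ?L) + ?L / 2"
      using int by (simp add: prob_space)
    also have "\<dots> \<le> ?L\<^sup>2 / (2 * ?L) + ?L / 2"
      using sq L by (intro add_right_mono divide_right_mono) auto
    also have "\<dots> = ?L" using L by (simp add: power2_eq_square)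
    finally have "(\<integral>x. \<bar>?d x\<bar> \<partial>M) \<le> ?L" .
    then show "(\<integral>\<^sup>+x. ennreal \<bar>?d x\<bar> \<partial>M) \<le> ennreal ?L"
      using int by (subst nn_integral_eq_integral) (auto intro: ennreal_leI)
  qed
qed

text \<open>The factor 2 is the sum of the geometric series started at \<open>i = 0\<close>. A
  finite integral also makes the pointwise series finite almost everywhere, which is how convergence
  is deduced later.\<close>

lemma nn_integral_suminf_geometric:
  assumes "\<And>i::nat. w i \<in> borel_measurable M" "0 < \<eta>"
    and "\<And>i. (\<integral>\<^sup>+x. w i x \<partial>M) \<le> ennreal (\<eta> / 2 ^ i)"
  shows "(\<integral>\<^sup>+x. (\<Sum>i. w i x) \<partial>M) \<le> ennreal (2 * \<eta>)"
proof -
  have sums: "(\<lambda>i. \<eta> / 2 ^ i) sums (2 * \<eta>)"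
    using sums_mult[OF geometric_sums[of "1/2::real"], of \<eta>]
    by (simp add: power_one_over field_simps)
  have "(\<integral>\<^sup>+x. (\<Sum>i. w i x) \<partial>M) = (\<Sum>i. \<integral>\<^sup>+x. w i x \<partial>M)"
    using assms by (intro nn_integral_suminf) auto
  also have "\<dots> \<le> (\<Sum>i. ennreal (\<eta> / 2 ^ i))"
    using assms by (intro suminf_le) auto
  also have "\<dots> = ennreal (2 * \<eta>)"
    using sums \<open>0 < \<eta>\<close> by (subst suminf_ennreal2) (auto simp: sums_iff)
  finally show ?thesis .
qed

text \<open>If the values stayed large, the function \<open>Y\<close> below, dominated by a member
  of every \<open>D n\<close>, would have to vanish by \<open>zero\<close>. Then u(f 0) is at most
  the total variation of the reciprocals, so \<open>sat_integral M (f 0)\<close> is small, and near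
  maximality spreads this to a whole \<open>D n\<close>.\<close>

lemma sat_integral_eventually_small:
  assumes D: "\<And>n::nat. nonneg_convex M (D n)" "\<And>n. D n \<noteq> {}" "decseq D"
    and zero: "\<And>Y. Y \<in> borel_measurable M \<Longrightarrow> (\<And>x. 0 \<le> Y x) \<Longrightarrow>
      (\<And>n. \<exists>f\<in>D n. \<forall>x. Y x \<le> f x) \<Longrightarrow> AE x in M. Y x = 0"
    and "0 < \<delta>"
  shows "\<exists>n. \<forall>f\<in>D n. sat_integral M f \<le> \<delta>"
proof (rule ccontr)
  assume "\<not> ?thesis"
  then have big: "\<And>n. \<exists>f\<in>D n. \<delta> < sat_integral M f" by (auto simp: not_le)
  \<comment> \<open>The contradiction at the end is \<delta> < 2\<eta> + \<eta>^2 \<le> 3\<eta> <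
    4\<eta> \<le> \<delta>; the cap at 1 gives \<eta>^2 \<le> \<eta>.\<close>
  define \<eta> where "\<eta> = min 1 \<delta> / 4"
  have \<eta>: "0 < \<eta>" "\<eta> \<le> 1" "4 * \<eta> \<le> \<delta>" using \<open>0 < \<delta>\<close> by (auto simp: \<eta>_def)
  obtain f where f: "\<And>i. \<exists>n\<ge>i. f i \<in> D n \<and> (\<forall>h\<in>D n. sat_integral M h \<le> sat_integral M (f i) + (\<eta> / 2 ^ i)\<^sup>2)"
    and close: "\<And>i. (\<integral>\<^sup>+x. ennreal \<bar>1 / (1 + f i x) - 1 / (1 + f (Suc i) x)\<bar> \<partial>M) \<le> ennreal (\<eta> / 2 ^ i)"
    by (rule near_maximisers_Cauchy[OF D \<eta>(1)]) (rule that)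
  have fD: "f i \<in> D i" for i using f[of i] decseqD[OF D(3)] by blast
  note f_nonneg = nonneg_convexD(2)[OF D(1) fD]
  have meas[measurable]: "f i \<in> borel_measurable M" for i
    using nonneg_convexD(1)[OF D(1) fD] .
  define w where "w i x = ennreal \<bar>1 / (1 + f i x) - 1 / (1 + f (Suc i) x)\<bar>" for i x
  have w_meas[measurable]: "w i \<in> borel_measurable M" for i unfolding w_def by measurable
  have S: "(\<integral>\<^sup>+x. (\<Sum>i. w i x) \<partial>M) \<le> ennreal (2 * \<eta>)"
    using close by (intro nn_integral_suminf_geometric \<eta>) (auto simp: w_def[symmetric])
  \<comment> \<open>Subtraction in \<open>ennreal\<close> truncates at 0, so this is a positive
    part. The minuend is finite, so \<open>enn2real\<close> loses nothing.\<close>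
  define Y where "Y x = enn2real (ennreal (f 0 x / (1 + f 0 x)) - (\<Sum>i. w i x))" for x
  \<comment> \<open>Telescoping: since u = 1 - v, each step changes u by at most
    \<open>w i x\<close>.\<close>
  have part: "ennreal (f 0 x / (1 + f 0 x)) \<le> (\<Sum>i<n. w i x) + ennreal (f n x / (1 + f n x))" for n x
  proof (induction n)
    case (Suc n)
    have "f n x / (1 + f n x) \<le> \<bar>1 / (1 + f n x) - 1 / (1 + f (Suc n) x)\<bar> + f (Suc n) x / (1 + f (Suc n) x)"
      unfolding frac_unit_bounds(5)[OF f_nonneg] by linarith
    then have "ennreal (f n x / (1 + f n x)) \<le> ennreal (\<bar>1 / (1 + f n x) - 1 / (1 + f (Suc n) x)\<bar> + f (Suc n) x / (1 + f (Suc n) x))"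
      by (rule ennreal_leI)
    also have "\<dots> = w n x + ennreal (f (Suc n) x / (1 + f (Suc n) x))"
      unfolding w_def by (intro ennreal_plus abs_ge_zero frac_unit_bounds(1)[OF f_nonneg])
    finally have "ennreal (f n x / (1 + f n x)) \<le> w n x + ennreal (f (Suc n) x / (1 + f (Suc n) x))" .
    then have "(\<Sum>i<n. w i x) + ennreal (f n x / (1 + f n x))
        \<le> (\<Sum>i<n. w i x) + (w n x + ennreal (f (Suc n) x / (1 + f (Suc n) x)))"
      by (intro add_left_mono)
    with Suc.IH show ?case unfolding sum.lessThan_Suc add.assoc by (rule order_trans)
  qed simp
  have diff_le: "ennreal (f 0 x / (1 + f 0 x)) - (\<Sum>i. w i x) \<le> ennreal (f n x / (1 + f n x))" for n x
  proof -
    have "(\<Sum>i<n. w i x) \<le> (\<Sum>i. w i x)" by (intro sum_le_suminf) auto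
    then have "ennreal (f 0 x / (1 + f 0 x)) \<le> (\<Sum>i. w i x) + ennreal (f n x / (1 + f n x))"
      using part[of x n] by (meson add_right_mono order_trans)
    then show ?thesis by (simp add: ennreal_minus_le_iff)
  qed
  have "AE x in M. Y x = 0"
  proof (rule zero)
    show "Y \<in> borel_measurable M" unfolding Y_def by measurable
    show "0 \<le> Y x" for x unfolding Y_def by simp
    show "\<exists>g\<in>D n. \<forall>x. Y x \<le> g x" for n
    proof (intro bexI[OF _ fD] allI)
      fix x
      have "Y x \<le> f n x / (1 + f n x)"
        unfolding Y_def using diff_le[of x n] f_nonneg by (intro enn2real_leI) auto
      then show "Y x \<le> f n x" using frac_unit_bounds(6)[OF f_nonneg] by (rule order_trans)
    qed
  qed
  then have "AE x in M. ennreal (f 0 x / (1 + f 0 x)) \<le> (\<Sum>i. w i x)"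
  proof eventually_elim
    case (elim x)
    have "ennreal (f 0 x / (1 + f 0 x)) - (\<Sum>i. w i x) \<noteq> top"
      by (simp add: ennreal_minus_eq_top)
    with elim have "ennreal (f 0 x / (1 + f 0 x)) - (\<Sum>i. w i x) = 0"
      unfolding Y_def by (simp add: enn2real_eq_0_iff)
    then show ?case by (simp add: ennreal_minus_eq_0)
  qed
  then have "(\<integral>\<^sup>+x. ennreal (f 0 x / (1 + f 0 x)) \<partial>M) \<le> (\<integral>\<^sup>+x. (\<Sum>i. w i x) \<partial>M)"
    by (rule nn_integral_mono_AE)
  moreover have "(\<integral>\<^sup>+x. ennreal (f 0 x / (1 + f 0 x)) \<partial>M) = ennreal (sat_integral M (f 0))"
    unfolding sat_integral_def
    by (intro nn_integral_eq_integral integrable_sat[OF D(1) fD] AE_I2 frac_unit_bounds(1)[OF f_nonneg])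
  ultimately have "sat_integral M (f 0) \<le> 2 * \<eta>"
    using S \<eta>(1) by (metis ennreal_le_iff mult_nonneg_nonneg less_imp_le order_trans zero_le_numeral)
  moreover obtain n h where "h \<in> D n" "\<delta> < sat_integral M h" "sat_integral M h \<le> sat_integral M (f 0) + \<eta>\<^sup>2"
    using f[of 0] big by fastforce
  moreover have "\<eta>\<^sup>2 \<le> \<eta>" using \<eta> by (simp add: power2_eq_square mult_left_le)
  ultimately show False using \<eta> by linarith
qed

section \<open>A density bounding a convex set in expectation\<close>

text \<open>The density is \<open>lim (1 / (1 + f\<^sub>n))\<^sup>2\<close> along a sequence of near maximisers \<open>f\<^sub>n\<close> of the
  concave functional \<^const>\<open>sat_integral\<close>; the bound on \<open>D\<close> is the first order optimality condition.\<close>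
lemma bounding_density:
  assumes D: "nonneg_convex M D" "D \<noteq> {}"
    and small: "\<And>f. f \<in> D \<Longrightarrow> sat_integral M f \<le> \<delta>"
  obtains g where "g \<in> borel_measurable M" "\<And>x. 0 \<le> g x" "\<And>x. g x \<le> (1::real)"
    "(\<integral>x. 1 - g x \<partial>M) \<le> 2 * \<delta>" "\<And>f. f \<in> D \<Longrightarrow> (\<integral>\<^sup>+x. ennreal (g x * f x) \<partial>M) \<le> 1"
proof -
  have "decseq (\<lambda>_::nat. D)" by (simp add: decseq_def)
  then obtain f where near: "\<And>i::nat. \<exists>n\<ge>i. f i \<in> D \<and> (\<forall>h\<in>D. sat_integral M h \<le> sat_integral M (f i) + (1 / 2 ^ i)\<^sup>2)"
    and close: "\<And>i. (\<integral>\<^sup>+x. ennreal \<bar>1 / (1 + f i x) - 1 / (1 + f (Suc i) x)\<bar> \<partial>M) \<le> ennreal (1 / 2 ^ i)"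
    by (rule near_maximisers_Cauchy[OF D _ zero_less_one]) (rule that)
  have f: "f i \<in> D" for i using near by blast
  have fmax: "sat_integral M h \<le> sat_integral M (f i) + (1 / 2 ^ i)\<^sup>2" if "h \<in> D" for h i
    using near[of i] that by blast
  note f_nonneg = nonneg_convexD(2)[OF D(1) f]
  have meas[measurable]: "f i \<in> borel_measurable M" for i
    using nonneg_convexD(1)[OF D(1) f] .
  define v where "v i x = 1 / (1 + f i x)" for i x
  have v_meas[measurable]: "v i \<in> borel_measurable M" for i unfolding v_def by measurable
  have v01: "0 < v i x" "v i x \<le> 1" for i x
    unfolding v_def using frac_unit_bounds(3,4)[OF f_nonneg] by auto
  define l where "l x = lim (\<lambda>i. v i x)" for x
  have l_meas[measurable]: "l \<in> borel_measurable M" unfolding l_def by measurable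
  \<comment> \<open>\<open>lim\<close> is unspecified where the sequence diverges. Capping the
    square at 1 keeps the bounds on \<open>g\<close> true everywhere, and by \<open>lim2\<close> the
    cap is inactive almost everywhere.\<close>
  define g where "g x = min 1 ((l x)\<^sup>2)" for x
  have g_meas[measurable]: "g \<in> borel_measurable M" unfolding g_def by measurable
  have "(\<integral>\<^sup>+x. (\<Sum>i. ennreal \<bar>v i x - v (Suc i) x\<bar>) \<partial>M) \<le> ennreal (2 * 1)"
    using close unfolding v_def by (intro nn_integral_suminf_geometric) auto
  then have "(\<integral>\<^sup>+x. (\<Sum>i. ennreal \<bar>v i x - v (Suc i) x\<bar>) \<partial>M) \<noteq> \<infinity>"
    by (auto simp: top_unique)
  then have "AE x in M. (\<Sum>i. ennreal \<bar>v i x - v (Suc i) x\<bar>) \<noteq> \<infinity>"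
    by (intro nn_integral_noteq_infinite) auto
  then have lim: "AE x in M. (\<lambda>i. v i x) \<longlonglongrightarrow> l x"
  proof eventually_elim
    case (elim x)
    then have "summable (\<lambda>i. \<bar>v i x - v (Suc i) x\<bar>)"
      by (intro summable_suminf_not_top) auto
    then have "summable (\<lambda>i. v i x - v (Suc i) x)" by (rule summable_rabs_cancel)
    then have "convergent (\<lambda>n. \<Sum>i<n. v i x - v (Suc i) x)" by (simp add: summable_iff_convergent)
    then have "convergent (\<lambda>n. v 0 x - v n x)" by (simp only: sum_lessThan_telescope'[of "\<lambda>n. v n x"])
    then have "convergent (\<lambda>n. v 0 x - (v 0 x - v n x))"
      by (rule convergent_diff[OF convergent_const])
    then show ?case unfolding l_def by (simp add: convergent_LIMSEQ_iff)
  qed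
  have lim2: "AE x in M. 0 \<le> l x \<and> l x \<le> 1 \<and> g x = (l x)\<^sup>2 \<and> (\<lambda>i. v i x) \<longlonglongrightarrow> l x"
    using lim
  proof eventually_elim
    case (elim x)
    have "0 \<le> l x" "l x \<le> 1"
      using v01 by (auto intro!: LIMSEQ_le_const[OF elim] LIMSEQ_le_const2[OF elim] simp: less_imp_le)
    then show ?case using elim by (simp add: g_def min_absorb2 power_le_one)
  qed
  show thesis
  proof (rule that[OF g_meas])
    show "0 \<le> g x" "g x \<le> 1" for x by (auto simp: g_def)
    have "(\<lambda>i. \<integral>x. 1 - (v i x)\<^sup>2 \<partial>M) \<longlonglongrightarrow> (\<integral>x. 1 - g x \<partial>M)"
    proof (rule integral_dominated_convergence[where w="\<lambda>_. 1"])
      show "AE x in M. (\<lambda>i. 1 - (v i x)\<^sup>2) \<longlonglongrightarrow> 1 - g x"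
        using lim2 by eventually_elim (auto intro!: tendsto_intros)
      show "AE x in M. norm (1 - (v i x)\<^sup>2) \<le> 1" for i
        using v01 by (auto simp: power_le_one less_imp_le)
    qed auto
    moreover have "(\<integral>x. 1 - (v i x)\<^sup>2 \<partial>M) \<le> 2 * \<delta>" for i
    proof -
      have "(\<integral>x. 1 - (v i x)\<^sup>2 \<partial>M) \<le> (\<integral>x. 2 * (f i x / (1 + f i x)) \<partial>M)"
      proof (rule integral_mono)
        show "integrable M (\<lambda>x. 1 - (v i x)\<^sup>2)"
          using v01 by (intro integrable_bounded[where B=1]) (auto simp: power_le_one less_imp_le)
        show "integrable M (\<lambda>x. 2 * (f i x / (1 + f i x)))"
          by (intro integrable_mult_right integrable_sat[OF D(1) f])
        show "1 - (v i x)\<^sup>2 \<le> 2 * (f i x / (1 + f i x))" for x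
        proof -
          have "0 \<le> (1 - v i x)\<^sup>2" by simp
          then have "1 - (v i x)\<^sup>2 \<le> 2 * (1 - v i x)" by (simp add: power2_eq_square algebra_simps)
          then show ?thesis unfolding frac_unit_bounds(5)[OF f_nonneg] v_def .
        qed
      qed
      also have "\<dots> = 2 * sat_integral M (f i)" unfolding sat_integral_def by (rule integral_mult_right_zero)
      also have "\<dots> \<le> 2 * \<delta>" using small[OF f] by simp
      finally show ?thesis .
    qed
    ultimately show "(\<integral>x. 1 - g x \<partial>M) \<le> 2 * \<delta>" by (intro LIMSEQ_le_const2) auto
  next
    fix h assume h: "h \<in> D"
    note h_nonneg = nonneg_convexD(2)[OF D(1) h]
    have [measurable]: "h \<in> borel_measurable M" using nonneg_convexD(1)[OF D(1) h] .
    \<comment> \<open>The step length towards \<open>h\<close> is the square root of the tolerance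
      in \<open>fmax\<close>. After division by \<open>t i\<close> the error is still
      \<open>t i\<close>, which tends to 0.\<close>
    define t where "t i = (1 / 2 ^ i :: real)" for i :: nat
    have t: "0 < t i" "t i \<le> 1" for i by (auto simp: t_def)
    have t_lim: "t \<longlonglongrightarrow> 0"
      using LIMSEQ_power_zero[of "1/2::real"] unfolding t_def by (simp add: power_one_over)
    define y where "y i x = (1 - t i) * f i x + t i * h x" for i x
    have yD: "y i \<in> D" for i
      unfolding y_def using t by (intro nonneg_convex_comb[OF D(1) f h]) (auto intro: less_imp_le)
    note y_nonneg = nonneg_convexD(2)[OF D(1) yD]
    have y_meas[measurable]: "y i \<in> borel_measurable M" for i unfolding y_def by measurable
    \<comment> \<open>With y = f + t(h - f) one has u(y) - u(f) = t (h - f) v(f) v(y). Near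
      maximality bounds the expectation of this by \<open>t i * t i\<close>, and the part containing
      f contributes at most 1.\<close>
    have bound: "(\<integral>\<^sup>+x. ennreal (h x * v i x / (1 + y i x)) \<partial>M) \<le> ennreal (1 + t i)" for i
    proof -
      let ?p = "\<lambda>x. h x * v i x / (1 + y i x)" and ?q = "\<lambda>x. f i x * v i x / (1 + y i x)"
      have p0: "0 \<le> ?p x" and p1: "?p x \<le> 1 / t i" and q0: "0 \<le> ?q x" and q1: "?q x \<le> 1" for x
      proof -
        show "0 \<le> ?p x" "0 \<le> ?q x" using h_nonneg f_nonneg y_nonneg v01 by (auto simp: less_imp_le)
        \<comment> \<open>The function \<open>h\<close> itself may fail to be integrable; the
          denominator \<open>1 + y i x\<close> dominates \<open>t i * h x\<close> and keeps the
          quotient bounded.\<close>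
        have "t i * h x \<le> y i x" unfolding y_def using t[of i] f_nonneg[of i x] by simp
        then have "h x / (1 + y i x) \<le> 1 / t i"
          using t[of i] y_nonneg[of i x] by (simp add: divide_simps mult.commute) 
        then have "v i x * (h x / (1 + y i x)) \<le> 1 * (1 / t i)"
          using v01[of i x] t[of i] h_nonneg[of x] y_nonneg[of i x] by (intro mult_mono) auto
        then show "?p x \<le> 1 / t i" by (simp add: mult.commute)
        have "f i x * v i x = f i x / (1 + f i x)" by (simp add: v_def)
        then have "f i x * v i x \<le> 1" using frac_unit_bounds(2)[OF f_nonneg, of i x] by simp
        also have "\<dots> \<le> 1 + y i x" using y_nonneg[of i x] by simp
        finally show "?q x \<le> 1" using y_nonneg[of i x] by (simp add: divide_simps)
      qed
      have ip: "integrable M ?p"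
      proof (rule integrable_bounded)
        show "\<bar>?p x\<bar> \<le> 1 / t i" for x using p0[of x] p1[of x] by linarith
      qed measurable
      have iq: "integrable M ?q"
      proof (rule integrable_bounded)
        show "\<bar>?q x\<bar> \<le> 1" for x using q0[of x] q1[of x] by linarith
      qed measurable
      have diff: "y i x / (1 + y i x) - f i x / (1 + f i x) = t i * (?p x - ?q x)" for x
      proof -
        have "y i x / (1 + y i x) - f i x / (1 + f i x) = (y i x - f i x) * v i x / (1 + y i x)"
          unfolding v_def using f_nonneg[of i x] y_nonneg[of i x] by (simp add: divide_simps) (simp add: algebra_simps)
        also have "y i x - f i x = t i * (h x - f i x)" by (simp add: y_def algebra_simps)
        finally show ?thesis by (simp add: diff_divide_distrib[symmetric] algebra_simps)
      qed
      have "t i * ((\<integral>x. ?p x \<partial>M) - (\<integral>x. ?q x \<partial>M)) = (\<integral>x. t i * (?p x - ?q x) \<partial>M)"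
        using ip iq by (simp del: times_divide_eq_right times_divide_eq_left)
      also have "\<dots> = sat_integral M (y i) - sat_integral M (f i)"
        unfolding diff[symmetric] sat_integral_def 
        by (intro Bochner_Integration.integral_diff integrable_sat[OF D(1)] f yD)
      also have "\<dots> \<le> t i * t i" using fmax[OF yD, of i i] by (simp add: t_def power2_eq_square)
      finally have "(\<integral>x. ?p x \<partial>M) \<le> (\<integral>x. ?q x \<partial>M) + t i" using t[of i] by simp
      also have "(\<integral>x. ?q x \<partial>M) \<le> (\<integral>x. 1 \<partial>M)" using iq q1 by (intro integral_mono) auto
      finally have "(\<integral>x. ?p x \<partial>M) \<le> 1 + t i" by (simp add: prob_space)
      then show ?thesis
        using p0 ip by (subst nn_integral_eq_integral) (auto intro: ennreal_leI)
    qed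
    \<comment> \<open>Preparation for Fatou's lemma. Where \<open>l x = 0\<close> the left side is
      0; elsewhere \<open>f i x\<close> and \<open>y i x\<close> share the finite limit
      \<open>1 / l x - 1\<close>, and the integrand tends to
      \<open>h x * (l x)\<^sup>2\<close>.\<close>
    have "AE x in M. ennreal (g x * h x) \<le> liminf (\<lambda>i. ennreal (h x * v i x / (1 + y i x)))"
      using lim2
    proof eventually_elim
      case (elim x)
      show ?case
      proof (cases "l x = 0")
        case True
        then show ?thesis using elim by simp
      next
        case False
        have "f i x = 1 / v i x - 1" for i unfolding v_def by simp
        then have "(\<lambda>i. f i x) \<longlonglongrightarrow> 1 / l x - 1"
          using elim False by (simp only:) (intro tendsto_intros, auto)
        then have "(\<lambda>i. y i x) \<longlonglongrightarrow> (1 - 0) * (1 / l x - 1) + 0 * h x"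
          unfolding y_def using t_lim by (intro tendsto_intros) auto
        then have "(\<lambda>i. ennreal (h x * v i x / (1 + y i x))) \<longlonglongrightarrow> ennreal (h x * l x / (1 + ((1 - 0) * (1 / l x - 1) + 0 * h x)))"
          using elim False by (intro tendsto_intros) auto
        moreover have "h x * l x / (1 + ((1 - 0) * (1 / l x - 1) + 0 * h x)) = g x * h x"
          using elim by (simp add: power2_eq_square)
        ultimately have "(\<lambda>i. ennreal (h x * v i x / (1 + y i x))) \<longlonglongrightarrow> ennreal (g x * h x)"
          by (simp only:)
        then show ?thesis by (simp add: lim_imp_Liminf)
      qed
    qed
    then have "(\<integral>\<^sup>+x. ennreal (g x * h x) \<partial>M)
        \<le> (\<integral>\<^sup>+x. liminf (\<lambda>i. ennreal (h x * v i x / (1 + y i x))) \<partial>M)"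
      by (rule nn_integral_mono_AE)
    also have "\<dots> \<le> liminf (\<lambda>i. \<integral>\<^sup>+x. ennreal (h x * v i x / (1 + y i x)) \<partial>M)"
      by (intro nn_integral_liminf) measurable
    also have "\<dots> \<le> liminf (\<lambda>i. ennreal (1 + t i))"
      using bound by (intro Liminf_mono) auto
    also have "\<dots> = 1"
    proof -
      have "(\<lambda>i. ennreal (1 + t i)) \<longlonglongrightarrow> ennreal (1 + 0)" using t_lim by (intro tendsto_intros)
      then show ?thesis by (simp add: lim_imp_Liminf)
    qed
    finally show "(\<integral>\<^sup>+x. ennreal (g x * h x) \<partial>M) \<le> 1" .
  qed
qed

end

section \<open>Convex hulls of the excesses over a level\<close>

lemma conv_shift_single:
  assumes "X \<in> \<X>"
  shows "(\<lambda>x. max (X x - real n) 0) \<in> conv_shift \<X> n"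
  unfolding conv_shift_def using assms
  by (auto intro!: exI[of _ "1::nat"] exI[of _ "\<lambda>_. 1::real"] exI[of _ "\<lambda>_. X"])

lemma conv_shift_nonneg: "Z \<in> conv_shift \<X> n \<Longrightarrow> 0 \<le> Z x"
  by (auto simp: conv_shift_def intro!: sum_nonneg)

lemma conv_shift_measurable:
  assumes "Z \<in> conv_shift \<X> n" "\<X> \<subseteq> borel_measurable M"
  shows "Z \<in> borel_measurable M"
proof -
  obtain k c F where F: "\<And>i. i < k \<Longrightarrow> F i \<in> \<X>"
    and Z: "Z = (\<lambda>x. \<Sum>i<(k::nat). c i * max (F i x - real n) 0)"
    using assms(1) by (auto simp: conv_shift_def)
  have [measurable]: "F i \<in> borel_measurable M" if "i < k" for i using F that assms(2) by blast
  show ?thesis unfolding Z by (rule borel_measurable_sum) auto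
qed

text \<open>Keep the coefficients and lower the level in every term. Only domination results, not
  inclusion of the hulls.\<close>

lemma conv_shift_antimono:
  assumes "Z \<in> conv_shift \<X> n" "m \<le> n"
  shows "\<exists>Z'\<in>conv_shift \<X> m. \<forall>x. Z x \<le> Z' x"
proof -
  obtain k c F where F: "\<forall>i<k. 0 \<le> c i" "(\<Sum>i<k. c i) = 1" "\<forall>i<k. F i \<in> \<X>"
    and Z: "Z = (\<lambda>x. \<Sum>i<(k::nat). c i * max (F i x - real n) 0)"
    using assms(1) by (auto simp: conv_shift_def)
  have "(\<lambda>x. \<Sum>i<k. c i * max (F i x - real m) 0) \<in> conv_shift \<X> m"
    unfolding conv_shift_def using F by blast
  then show ?thesis
  proof (rule bexI[rotated], intro allI)
    show "Z x \<le> (\<Sum>i<k. c i * max (F i x - real m) 0)" for x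
      unfolding Z using F(1) \<open>m \<le> n\<close> by (intro sum_mono mult_left_mono) auto
  qed
qed

lemma sum_append_lessThan:
  fixes a b :: "nat \<Rightarrow> real"
  shows "(\<Sum>i<m + n. if i < m then a i else b (i - m)) = (\<Sum>i<m. a i) + (\<Sum>i<n. b i)"
  by (induction n) auto

text \<open>The two finite combinations are concatenated, the second shifted by the length of the
  first, with coefficients scaled by \<open>1 - t\<close> and \<open>t\<close>.\<close>

lemma conv_shift_convex:
  assumes "Z1 \<in> conv_shift \<X> n" "Z2 \<in> conv_shift \<X> n" "0 \<le> t" "t \<le> 1"
  shows "(\<lambda>x. (1 - t) * Z1 x + t * Z2 x) \<in> conv_shift \<X> n"
proof -
  obtain k c F where 1: "\<forall>i<k. 0 \<le> c i" "(\<Sum>i<k. c i) = 1" "\<forall>i<k. F i \<in> \<X>"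
    and Z1: "Z1 = (\<lambda>x. \<Sum>i<(k::nat). c i * max (F i x - real n) 0)"
    using assms(1) by (auto simp: conv_shift_def)
  obtain l d G where 2: "\<forall>i<l. 0 \<le> d i" "(\<Sum>i<l. d i) = 1" "\<forall>i<l. G i \<in> \<X>"
    and Z2: "Z2 = (\<lambda>x. \<Sum>i<(l::nat). d i * max (G i x - real n) 0)"
    using assms(2) by (auto simp: conv_shift_def)
  define e where "e i = (if i < k then (1 - t) * c i else t * d (i - k))" for i
  define H where "H i = (if i < k then F i else G (i - k))" for i
  have "\<forall>i<k + l. 0 \<le> e i" using 1(1) 2(1) assms(3,4) by (auto simp: e_def)
  moreover have "(\<Sum>i<k + l. e i) = 1"
    unfolding e_def sum_append_lessThan[where a="\<lambda>i. (1 - t) * c i" and b="\<lambda>i. t * d i"]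
    using 1(2) 2(2) by (simp add: sum_distrib_left[symmetric])
  moreover have "\<forall>i<k + l. H i \<in> \<X>" using 1(3) 2(3) by (auto simp: H_def)
  moreover have "(1 - t) * Z1 x + t * Z2 x = (\<Sum>i<k + l. e i * max (H i x - real n) 0)" for x
  proof -
    have "(\<Sum>i<k + l. e i * max (H i x - real n) 0) = (\<Sum>i<k + l. if i < k
        then (1 - t) * (c i * max (F i x - real n) 0)
        else t * (d (i - k) * max (G (i - k) x - real n) 0))"
      by (intro sum.cong) (auto simp: e_def H_def)
    also have "\<dots> = (1 - t) * Z1 x + t * Z2 x"
      unfolding Z1 Z2 sum_distrib_left by (rule sum_append_lessThan)
    finally show ?thesis by simp
  qed
  ultimately show ?thesis unfolding conv_shift_def by blast
qed

text \<open>Unlike \<^const>\<open>conv_shift\<close> itself, its lower hulls are nested.\<close>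
definition lower_hull :: "'a measure \<Rightarrow> ('a \<Rightarrow> real) set \<Rightarrow> real \<Rightarrow> nat \<Rightarrow> ('a \<Rightarrow> real) set" where
  "lower_hull M \<X> K n =
     {f \<in> borel_measurable M. (\<forall>x. 0 \<le> f x) \<and> (\<exists>Z\<in>conv_shift \<X> n. \<forall>x. f x \<le> K * Z x)}"

lemma lower_hull_scaled:
  assumes "\<X> \<subseteq> borel_measurable M" "Z \<in> conv_shift \<X> n" "0 \<le> K"
  shows "(\<lambda>x. K * Z x) \<in> lower_hull M \<X> K n"
proof -
  have [measurable]: "Z \<in> borel_measurable M" using conv_shift_measurable assms by blast
  have "(\<lambda>x. K * Z x) \<in> borel_measurable M" by measurable
  then show ?thesis
    unfolding lower_hull_def using assms conv_shift_nonneg[OF assms(2)] by auto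
qed

lemma nonneg_convex_lower_hull:
  assumes "0 \<le> K"
  shows "nonneg_convex M (lower_hull M \<X> K n)"
  unfolding nonneg_convex_def
proof (intro conjI ballI)
  fix f g t assume f: "f \<in> lower_hull M \<X> K n" and g: "g \<in> lower_hull M \<X> K n"
    and t: "t \<in> {0..(1::real)}"
  obtain Z1 Z2 where Z: "Z1 \<in> conv_shift \<X> n" "Z2 \<in> conv_shift \<X> n"
    and le: "\<And>x. f x \<le> K * Z1 x" "\<And>x. g x \<le> K * Z2 x"
    using f g by (auto simp: lower_hull_def)
  have "(1 - t) * f x + t * g x \<le> K * ((1 - t) * Z1 x + t * Z2 x)" for x
  proof -
    have "(1 - t) * f x + t * g x \<le> (1 - t) * (K * Z1 x) + t * (K * Z2 x)"
      using t le by (intro add_mono mult_left_mono) auto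
    then show ?thesis by (simp add: algebra_simps)
  qed
  moreover have "(\<lambda>x. (1 - t) * Z1 x + t * Z2 x) \<in> conv_shift \<X> n"
    using conv_shift_convex[OF Z] t by auto
  moreover have "(\<lambda>x. (1 - t) * f x + t * g x) \<in> borel_measurable M"
    using f g by (auto simp: lower_hull_def)
  moreover have "0 \<le> (1 - t) * f x + t * g x" for x
    using f g t by (auto simp: lower_hull_def)
  ultimately show "(\<lambda>x. (1 - t) * f x + t * g x) \<in> lower_hull M \<X> K n"
    unfolding lower_hull_def
    by (auto intro!: bexI[of _ "\<lambda>x. (1 - t) * Z1 x + t * Z2 x"])
qed (auto simp: lower_hull_def)

lemma decseq_lower_hull:
  assumes "0 \<le> K"
  shows "decseq (lower_hull M \<X> K)"
proof (intro decseq_SucI subsetI)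
  fix n f assume f: "f \<in> lower_hull M \<X> K (Suc n)"
  then obtain Z where Z: "Z \<in> conv_shift \<X> (Suc n)" "\<And>x. f x \<le> K * Z x"
    by (auto simp: lower_hull_def)
  obtain Z' where Z': "Z' \<in> conv_shift \<X> n" "\<And>x. Z x \<le> Z' x"
    using conv_shift_antimono[OF Z(1), of n] by auto
  have "f x \<le> K * Z' x" for x
    using Z(2)[of x] mult_left_mono[OF Z'(2)[of x] assms] by linarith
  then show "f \<in> lower_hull M \<X> K n" using f Z'(1) by (auto simp: lower_hull_def)
qed

section \<open>Construction of the equivalent probability\<close>

context prob_space
begin

text \<open>\<open>sat_integral_eventually_small\<close> supplies a level \<open>N\<close> at which
  the scaled lower hull is small, and \<open>bounding_density\<close> turns this smallness into a
  density.\<close>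

lemma tail_densities:
  assumes X: "\<X> \<subseteq> borel_measurable M" "\<X> \<noteq> {}"
    and O: "\<And>Y. (\<And>n. Y \<in> O_set M \<X> n) \<Longrightarrow> AE x in M. Y x = 0" and "0 < \<epsilon>"
  obtains N :: nat and g where "g \<in> borel_measurable M" "\<And>x. 0 \<le> g x" "\<And>x. g x \<le> (1::real)"
    "(\<integral>x. 1 - g x \<partial>M) \<le> \<epsilon>"
    "\<And>X. X \<in> \<X> \<Longrightarrow> (\<integral>\<^sup>+x. ennreal (g x) * ennreal (max (X x - real N) 0) \<partial>M) \<le> ennreal \<epsilon>"
proof -
  \<comment> \<open>The bound 1 of \<open>bounding_density\<close> on \<open>K * Z\<close> becomes
    \<epsilon> on \<open>Z\<close>.\<close>
  define K where "K = 1 / \<epsilon>"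
  have K: "0 < K" "0 \<le> K" using \<open>0 < \<epsilon>\<close> by (auto simp: K_def)
  have ne: "lower_hull M \<X> K n \<noteq> {}" for n
    using lower_hull_scaled[OF X(1) conv_shift_single K(2)] X(2) by blast
  \<comment> \<open>The half compensates for the factor 2 in the estimate of \<open>1 - g\<close> in
    \<open>bounding_density\<close>.\<close>
  have "\<exists>n. \<forall>f\<in>lower_hull M \<X> K n. sat_integral M f \<le> \<epsilon> / 2"
  proof (rule sat_integral_eventually_small[OF nonneg_convex_lower_hull[OF K(2)] ne decseq_lower_hull[OF K(2)]])
    fix Y assume Y: "Y \<in> borel_measurable M" "\<And>x. 0 \<le> Y x" "\<And>n. \<exists>f\<in>lower_hull M \<X> K n. \<forall>x. Y x \<le> f x"
    \<comment> \<open>Division by \<open>K\<close> moves a common minorant of the scaled hulls into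
      every \<open>O_set\<close>, so the hypothesis applies at any scale.\<close>
    have "AE x in M. Y x / K = 0"
    proof (rule O)
      fix n
      obtain Z where Z: "Z \<in> conv_shift \<X> n" "\<And>x. Y x \<le> K * Z x"
        using Y(3)[of n] by (fastforce simp: lower_hull_def intro: order_trans)
      have "Y x / K \<le> Z x" for x using Z(2)[of x] K by (simp add: divide_simps mult.commute)
      then show "(\<lambda>x. Y x / K) \<in> O_set M \<X> n"
        unfolding O_set_def L0_plus_def using Y(1,2) Z(1) K by auto
    qed
    then show "AE x in M. Y x = 0" using K by auto
  qed (use \<open>0 < \<epsilon>\<close> in auto)
  then obtain N where N: "\<And>f. f \<in> lower_hull M \<X> K N \<Longrightarrow> sat_integral M f \<le> \<epsilon> / 2" by blast
  obtain g where g: "g \<in> borel_measurable M" "\<And>x. 0 \<le> g x" "\<And>x. g x \<le> (1::real)"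
      "(\<integral>x. 1 - g x \<partial>M) \<le> 2 * (\<epsilon> / 2)"
    and gf: "\<And>f. f \<in> lower_hull M \<X> K N \<Longrightarrow> (\<integral>\<^sup>+x. ennreal (g x * f x) \<partial>M) \<le> 1"
    by (rule bounding_density[OF nonneg_convex_lower_hull[OF K(2)] ne N]) (assumption, rule that)
  show thesis
  proof (rule that[OF g(1-3)])
    show "(\<integral>x. 1 - g x \<partial>M) \<le> \<epsilon>" using g(4) by simp
    fix X assume "X \<in> \<X>"
    have [measurable]: "X \<in> borel_measurable M" "g \<in> borel_measurable M" using X \<open>X \<in> \<X>\<close> g by auto
    have scale: "ennreal a * ennreal m = ennreal \<epsilon> * ennreal (a * (K * m))" if "0 \<le> a" "0 \<le> m" for a m
      using that \<open>0 < \<epsilon>\<close> by (simp add: ennreal_mult[symmetric] K_def)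
    have "ennreal (g x) * ennreal (max (X x - real N) 0)
        = ennreal \<epsilon> * ennreal (g x * (K * max (X x - real N) 0))" for x
      by (rule scale[OF g(2)]) simp
    then have "(\<integral>\<^sup>+x. ennreal (g x) * ennreal (max (X x - real N) 0) \<partial>M)
        = ennreal \<epsilon> * (\<integral>\<^sup>+x. ennreal (g x * (K * max (X x - real N) 0)) \<partial>M)"
      by (simp add: nn_integral_cmult)
    also have "\<dots> \<le> ennreal \<epsilon> * 1"
      by (intro mult_left_mono gf lower_hull_scaled[OF X(1) conv_shift_single[OF \<open>X \<in> \<X>\<close>] K(2)]) auto
    finally show "(\<integral>\<^sup>+x. ennreal (g x) * ennreal (max (X x - real N) 0) \<partial>M) \<le> ennreal \<epsilon>" by simp
  qed
qed

text \<open>Normalising by the total integral gives mass 1, and almost everywhere positivity of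
  \<open>H\<close> keeps the null sets. Positivity of the integral is exported because its inverse
  must be finite later.\<close>

lemma equiv_prob_density:
  assumes [measurable]: "H \<in> borel_measurable M"
    and pos: "AE x in M. 0 < H x" and fin: "(\<integral>\<^sup>+x. H x \<partial>M) < \<infinity>"
  shows "equiv_prob M (density M (\<lambda>x. H x / (\<integral>\<^sup>+x. H x \<partial>M)))" "0 < (\<integral>\<^sup>+x. H x \<partial>M)"
proof -
  define c where "c = (\<integral>\<^sup>+x. H x \<partial>M)"
  have "c \<noteq> 0"
  proof
    assume "c = 0"
    then have "AE x in M. H x = 0" by (simp add: c_def nn_integral_0_iff_AE)
    with pos have "AE x in M. False" by eventually_elim simp
    then show False by simp
  qed
  then show c0: "0 < (\<integral>\<^sup>+x. H x \<partial>M)" by (simp add: c_def zero_less_iff_neq_zero)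
  have cf: "c < \<infinity>" using fin by (simp add: c_def)
  define Q where "Q = density M (\<lambda>x. H x / c)"
  have [simp]: "sets Q = sets M" "space Q = space M" by (simp_all add: Q_def)
  have "prob_space Q"
  proof
    have "emeasure Q (space Q) = (\<integral>\<^sup>+x. H x / c * indicator (space M) x \<partial>M)"
      by (simp add: Q_def emeasure_density)
    also have "\<dots> = (\<integral>\<^sup>+x. H x / c \<partial>M)" by (intro nn_integral_cong) simp
    also have "\<dots> = c / c" by (simp add: nn_integral_divide c_def)
    also have "\<dots> = 1" using \<open>c \<noteq> 0\<close> cf by (intro ennreal_divide_self) auto
    finally show "emeasure Q (space Q) = 1" .
  qed
  moreover have "emeasure Q A = 0 \<longleftrightarrow> emeasure M A = 0" if A: "A \<in> sets M" for A
  proof -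
    have "emeasure Q A = 0 \<longleftrightarrow> A \<in> null_sets Q" using A by (simp add: null_sets_def)
    also have "\<dots> \<longleftrightarrow> (AE x in M. x \<in> A \<longrightarrow> H x / c = 0)"
      using A by (simp add: Q_def null_sets_density_iff)
    also have "\<dots> \<longleftrightarrow> (AE x in M. x \<notin> A)"
    proof
      assume "AE x in M. x \<in> A \<longrightarrow> H x / c = 0"
      with pos show "AE x in M. x \<notin> A"
        by eventually_elim (use cf in \<open>auto simp: ennreal_divide_eq_0_iff\<close>)
    qed (auto elim!: eventually_mono)
    also have "\<dots> \<longleftrightarrow> A \<in> null_sets M" using A by (simp add: AE_iff_null_sets)
    also have "\<dots> \<longleftrightarrow> emeasure M A = 0" using A by (simp add: null_sets_def)
    finally show ?thesis .
  qed
  ultimately show "equiv_prob M (density M (\<lambda>x. H x / (\<integral>\<^sup>+x. H x \<partial>M)))"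
    by (simp add: equiv_prob_def Q_def c_def)
qed

text \<open>Since \<open>h j\<close> lies below every \<open>g i\<close> with
  \<open>i \<ge> j\<close>, the tails weighted by \<open>h j\<close> vanish uniformly over \<X>. A
  single \<open>h j\<close> may vanish on a set of positive measure, so all of them are summed with
  weights.\<close>

lemma exists_unif_integrable:
  assumes X: "\<X> \<subseteq> borel_measurable M" "\<X> \<noteq> {}"
    and O: "\<And>Y. (\<And>n. Y \<in> O_set M \<X> n) \<Longrightarrow> AE x in M. Y x = 0"
  shows "\<exists>Q. equiv_prob M Q \<and> unif_integrable Q \<X>"
proof -
  \<comment> \<open>Packs the conclusions of \<open>tail_densities\<close> into one predicate, so
    that levels and densities can be chosen as sequences.\<close>
  define good where "good i N g \<longleftrightarrow> g \<in> borel_measurable M \<and> (\<forall>x. 0 \<le> g x) \<and> (\<forall>x. g x \<le> (1::real)) \<and>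
      (\<integral>x. 1 - g x \<partial>M) \<le> 1 / 2 ^ i \<and>
      (\<forall>X\<in>\<X>. (\<integral>\<^sup>+x. ennreal (g x) * ennreal (max (X x - real N) 0) \<partial>M) \<le> ennreal (1 / 2 ^ i))"
    for i N :: nat and g
  have "\<exists>N g. good i N g" for i
    unfolding good_def by (rule tail_densities[OF X O, of "1 / 2 ^ i"]) (assumption, simp, blast)
  then obtain N g where good: "\<And>i. good i (N i) (g i)" by metis
  have g_meas[measurable]: "g i \<in> borel_measurable M"
    and g01: "0 \<le> g i x" "g i x \<le> 1"
    and g_int: "(\<integral>x. 1 - g i x \<partial>M) \<le> 1 / 2 ^ i"
    and g_tail: "X \<in> \<X> \<Longrightarrow>
      (\<integral>\<^sup>+x. ennreal (g i x) * ennreal (max (X x - real (N i)) 0) \<partial>M) \<le> ennreal (1 / 2 ^ i)"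
    for i x X
    using good[of i] by (auto simp: good_def)
  define h where "h j x = (INF i\<in>{j..}. ennreal (g i x))" for j x
  have h_meas[measurable]: "h j \<in> borel_measurable M" for j unfolding h_def by measurable
  have h_le: "h j x \<le> ennreal (g i x)" if "j \<le> i" for i j x
    unfolding h_def using that by (intro INF_lower) auto
  have h_le1: "h j x \<le> 1" for j x
    using h_le[of j j x] g01(2)[of j x] by (meson order_refl order_trans ennreal_le_1)
  have h_pos: "AE x in M. \<exists>j. 0 < h j x"
  \<comment> \<open>A Borel-Cantelli argument: the expectations of \<open>1 - g i\<close> are
    summable, so \<open>g i x\<close> tends to 1 almost everywhere and exceeds 1/2 from some index
    on.\<close>
  proof -
    have "(\<integral>\<^sup>+x. ennreal (1 - g i x) \<partial>M) \<le> ennreal (1 / 2 ^ i)" for i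
      using g01 g_int
      by (subst nn_integral_eq_integral) (auto intro!: integrable_bounded[where B=1] ennreal_leI)
    then have "(\<integral>\<^sup>+x. (\<Sum>i. ennreal (1 - g i x)) \<partial>M) \<le> ennreal (2 * 1)"
      by (intro nn_integral_suminf_geometric) auto
    then have "(\<integral>\<^sup>+x. (\<Sum>i. ennreal (1 - g i x)) \<partial>M) \<noteq> \<infinity>" by (auto simp: top_unique)
    then have "AE x in M. (\<Sum>i. ennreal (1 - g i x)) \<noteq> \<infinity>"
      by (intro nn_integral_noteq_infinite) auto
    then show ?thesis
    proof eventually_elim
      case (elim x)
      then have "summable (\<lambda>i. 1 - g i x)" using g01 by (intro summable_suminf_not_top) auto
      then have "eventually (\<lambda>i. 1 - g i x < 1 / 2) sequentially"
        by (intro order_tendstoD(2)[OF summable_LIMSEQ_zero]) auto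
      then obtain j where j: "\<And>i. j \<le> i \<Longrightarrow> 1 - g i x < 1 / 2"
        by (auto simp: eventually_sequentially)
      have "ennreal (1 / 2) \<le> h j x"
        unfolding h_def using j by (intro INF_greatest ennreal_leI) force
      then have "0 < h j x" by (rule less_le_trans[rotated]) (subst ennreal_less_zero_iff, simp)
      then show ?case ..
    qed
  qed
  define T where "T X n x = ennreal (X x * indicator {x. X x > real n} x)" for X :: "'a \<Rightarrow> real" and n x
  have T_meas[measurable]: "T X n \<in> borel_measurable M" if "X \<in> \<X>" for X n
  proof -
    have [measurable]: "X \<in> borel_measurable M" using that X by auto
    have "T X n = (\<lambda>x. ennreal (if X x > real n then X x else 0))"
      by (auto simp: T_def fun_eq_iff indicator_def)
    then show ?thesis by simp
  qed
  define b where "b j n = (SUP X\<in>\<X>. \<integral>\<^sup>+x. h j x * T X n x \<partial>M)" for j n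
  \<comment> \<open>A bound uniform in n, needed for domination: a tail of \<open>X\<close> is at
    most \<open>N j\<close> plus the excess over \<open>N j\<close>.\<close>
  have b_bound: "b j n \<le> ennreal (real (N j) + 1)" for j n
    unfolding b_def
  proof (rule SUP_least)
    fix X assume "X \<in> \<X>"
    then have [measurable]: "X \<in> borel_measurable M" using X by auto
    have "h j x * T X n x \<le> ennreal (real (N j)) + ennreal (g j x) * ennreal (max (X x - real (N j)) 0)" for x
    proof -
      have "T X n x \<le> ennreal (real (N j) + max (X x - real (N j)) 0)"
        unfolding T_def by (intro ennreal_leI) (auto simp: indicator_def)
      also have "\<dots> = ennreal (real (N j)) + ennreal (max (X x - real (N j)) 0)"
        by (intro ennreal_plus) auto
      finally have "h j x * T X n x \<le> h j x * ennreal (real (N j)) + h j x * ennreal (max (X x - real (N j)) 0)"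
        by (metis distrib_left mult_left_mono zero_le)
      also have "\<dots> \<le> 1 * ennreal (real (N j)) + ennreal (g j x) * ennreal (max (X x - real (N j)) 0)"
        by (intro add_mono mult_right_mono h_le h_le1) auto
      finally show ?thesis by simp
    qed
    then have "(\<integral>\<^sup>+x. h j x * T X n x \<partial>M)
        \<le> (\<integral>\<^sup>+x. ennreal (real (N j)) + ennreal (g j x) * ennreal (max (X x - real (N j)) 0) \<partial>M)"
      by (intro nn_integral_mono)
    also have "\<dots> = ennreal (real (N j)) + (\<integral>\<^sup>+x. ennreal (g j x) * ennreal (max (X x - real (N j)) 0) \<partial>M)"
      by (subst nn_integral_add) (auto simp: emeasure_space_1)
    also have "\<dots> \<le> ennreal (real (N j)) + ennreal 1"
      using g_tail[OF \<open>X \<in> \<X>\<close>, of j] by (intro add_left_mono) (erule order_trans, intro ennreal_leI, simp)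
    also have "\<dots> = ennreal (real (N j) + 1)" by (intro ennreal_plus[symmetric]) auto
    finally show "(\<integral>\<^sup>+x. h j x * T X n x \<partial>M) \<le> ennreal (real (N j) + 1)" .
  qed
  \<comment> \<open>If \<open>X x > n \<ge> 2 * N i\<close>, then
    \<open>X x \<le> 2 * (X x - N i)\<close>, so the tail is controlled by the excess over
    \<open>N i\<close>.\<close>
  have b_tail: "b j n \<le> ennreal (2 / 2 ^ i)" if "j \<le> i" "2 * N i \<le> n" for i j n
    unfolding b_def
  proof (rule SUP_least)
    fix X assume "X \<in> \<X>"
    then have [measurable]: "X \<in> borel_measurable M" using X by auto
    have "h j x * T X n x \<le> 2 * (ennreal (g i x) * ennreal (max (X x - real (N i)) 0))" for x
    proof -
      have "T X n x \<le> ennreal (2 * max (X x - real (N i)) 0)"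
        unfolding T_def using that(2) by (intro ennreal_leI) (auto simp: indicator_def)
      also have "\<dots> = 2 * ennreal (max (X x - real (N i)) 0)" by (simp add: ennreal_mult')
      finally have "h j x * T X n x \<le> ennreal (g i x) * (2 * ennreal (max (X x - real (N i)) 0))"
        by (intro mult_mono h_le that) auto
      then show ?thesis by (simp add: mult.left_commute)
    qed
    then have "(\<integral>\<^sup>+x. h j x * T X n x \<partial>M)
        \<le> (\<integral>\<^sup>+x. 2 * (ennreal (g i x) * ennreal (max (X x - real (N i)) 0)) \<partial>M)"
      by (intro nn_integral_mono)
    also have "\<dots> = 2 * (\<integral>\<^sup>+x. ennreal (g i x) * ennreal (max (X x - real (N i)) 0) \<partial>M)"
      by (intro nn_integral_cmult) measurable
    also have "\<dots> \<le> 2 * ennreal (1 / 2 ^ i)"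
      by (intro mult_left_mono g_tail \<open>X \<in> \<X>\<close>) auto
    also have "\<dots> = ennreal (2 * (1 / 2 ^ i))" by (subst ennreal_mult') auto
    finally show "(\<integral>\<^sup>+x. h j x * T X n x \<partial>M) \<le> ennreal (2 / 2 ^ i)" by simp
  qed
  have b_lim: "(\<lambda>n. b j n) \<longlonglongrightarrow> 0" for j
  proof (rule order_tendstoI)
    fix a :: ennreal assume "0 < a"
    have "(\<lambda>i. ennreal (2 * (1 / 2) ^ i)) \<longlonglongrightarrow> ennreal (2 * 0)"
      by (intro tendsto_intros LIMSEQ_power_zero) auto
    then have "eventually (\<lambda>i. ennreal (2 * (1 / 2) ^ i) < a) sequentially"
      using \<open>0 < a\<close> by (intro order_tendstoD(2)) auto
    then have "eventually (\<lambda>i. ennreal (2 * (1 / 2) ^ i) < a \<and> j \<le> i) sequentially"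
      by (intro eventually_conj eventually_ge_at_top)
    then obtain i where i: "ennreal (2 / 2 ^ i) < a" "j \<le> i"
      by (auto simp: eventually_sequentially power_one_over)
    show "eventually (\<lambda>n. b j n < a) sequentially"
      using eventually_ge_at_top[of "2 * N i"]
      by eventually_elim (use b_tail[OF i(2)] i(1) in \<open>auto intro: le_less_trans\<close>)
  qed simp
  \<comment> \<open>The factor \<open>1 / 2 ^ j\<close> makes \<open>H\<close> integrable; dividing
    by the bound of \<open>b_bound\<close> gives \<open>w j * b j n \<le> 1 / 2 ^ j\<close> for
    every n.\<close>
  define w where "w j = 1 / 2 ^ j / (real (N j) + 1)" for j
  have w: "0 < w j" "w j \<le> 1 / 2 ^ j" for j by (auto simp: w_def divide_simps)
  define H where "H x = (\<Sum>j. ennreal (w j) * h j x)" for x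
  have H_meas[measurable]: "H \<in> borel_measurable M" unfolding H_def by measurable
  have H_pos: "AE x in M. 0 < H x"
    using h_pos
  proof eventually_elim
    case (elim x)
    then obtain j where "0 < h j x" ..
    then have "0 < ennreal (w j) * h j x" using w(1)[of j] by (simp add: ennreal_zero_less_mult_iff)
    also have "\<dots> = (\<Sum>j\<in>{j}. ennreal (w j) * h j x)" by simp
    also have "\<dots> \<le> H x" unfolding H_def by (intro sum_le_suminf) auto
    finally show ?case .
  qed
  have "(\<integral>\<^sup>+x. H x \<partial>M) \<le> ennreal (2 * 1)"
    unfolding H_def
  proof (rule nn_integral_suminf_geometric)
    fix i
    have "(\<integral>\<^sup>+x. ennreal (w i) * h i x \<partial>M) \<le> (\<integral>\<^sup>+x. ennreal (1 / 2 ^ i) * 1 \<partial>M)"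
      using w by (intro nn_integral_mono mult_mono h_le1 ennreal_leI) auto
    then show "(\<integral>\<^sup>+x. ennreal (w i) * h i x \<partial>M) \<le> ennreal (1 / 2 ^ i)"
      by (simp add: emeasure_space_1)
  qed auto
  then have H_fin: "(\<integral>\<^sup>+x. H x \<partial>M) < \<infinity>" by (rule le_less_trans) simp
  define c where "c = (\<integral>\<^sup>+x. H x \<partial>M)"
  define Q where "Q = density M (\<lambda>x. H x / c)"
  have Q: "equiv_prob M Q" and c0: "0 < c"
    using equiv_prob_density[OF H_meas H_pos H_fin] by (simp_all add: Q_def c_def)
  have le: "(SUP X\<in>\<X>. \<integral>\<^sup>+x. T X n x \<partial>Q) \<le> inverse c * (\<Sum>j. ennreal (w j) * b j n)" for n
  proof (rule SUP_least)
    fix X assume "X \<in> \<X>"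
    note T_meas[OF this, measurable]
    have "(\<integral>\<^sup>+x. T X n x \<partial>Q) = (\<integral>\<^sup>+x. inverse c * (H x * T X n x) \<partial>M)"
      unfolding Q_def by (subst nn_integral_density) (auto simp: divide_ennreal_def mult_ac)
    also have "\<dots> = inverse c * (\<integral>\<^sup>+x. H x * T X n x \<partial>M)"
      by (intro nn_integral_cmult) measurable
    also have "(\<integral>\<^sup>+x. H x * T X n x \<partial>M) = (\<integral>\<^sup>+x. (\<Sum>j. ennreal (w j) * (h j x * T X n x)) \<partial>M)"
      unfolding H_def by (simp add: ennreal_suminf_multc[symmetric] mult.assoc)
    also have "\<dots> = (\<Sum>j. \<integral>\<^sup>+x. ennreal (w j) * (h j x * T X n x) \<partial>M)"
      by (intro nn_integral_suminf) measurable
    also have "\<dots> = (\<Sum>j. ennreal (w j) * (\<integral>\<^sup>+x. h j x * T X n x \<partial>M))"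
      by (intro suminf_cong nn_integral_cmult) measurable
    also have "\<dots> \<le> (\<Sum>j. ennreal (w j) * b j n)"
      unfolding b_def using \<open>X \<in> \<X>\<close> by (intro suminf_le mult_left_mono SUP_upper) auto
    finally show "(\<integral>\<^sup>+x. T X n x \<partial>Q) \<le> inverse c * (\<Sum>j. ennreal (w j) * b j n)"
      by (simp add: mult_left_mono)
  qed
  \<comment> \<open>The series over j is read as an integral for counting measure, so that dominated
    convergence permits the limit in n term by term.\<close>
  have "(\<lambda>n. \<integral>\<^sup>+j. ennreal (w j) * b j n \<partial>count_space UNIV) \<longlonglongrightarrow> (\<integral>\<^sup>+j. 0 \<partial>count_space (UNIV::nat set))"
  proof (rule nn_integral_dominated_convergence[where w="\<lambda>j. ennreal (1 / 2 ^ j)"])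
    have "(\<Sum>j. ennreal (1 / 2 ^ j)) = ennreal 2"
      using geometric_sums[of "1/2::real"]
      by (subst suminf_ennreal2) (auto simp: sums_iff power_one_over)
    then show "(\<integral>\<^sup>+j. ennreal (1 / 2 ^ j) \<partial>count_space UNIV) < \<infinity>"
      by (simp add: nn_integral_count_space_nat)
    show "AE j in count_space UNIV. ennreal (w j) * b j n \<le> ennreal (1 / 2 ^ j)" for n
    proof (rule AE_I2)
      fix j
      have "ennreal (w j) * b j n \<le> ennreal (w j) * ennreal (real (N j) + 1)"
        by (intro mult_left_mono b_bound) auto
      also have "\<dots> = ennreal (w j * (real (N j) + 1))"
        using w(1)[of j] by (intro ennreal_mult[symmetric]) auto
      also have "w j * (real (N j) + 1) = 1 / 2 ^ j" by (simp add: w_def)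
      finally show "ennreal (w j) * b j n \<le> ennreal (1 / 2 ^ j)" .
    qed
    show "AE j in count_space UNIV. (\<lambda>n. ennreal (w j) * b j n) \<longlonglongrightarrow> 0"
      using ennreal_tendsto_cmult[OF _ b_lim] by (intro AE_I2) force
  qed auto
  then have "(\<lambda>n. \<Sum>j. ennreal (w j) * b j n) \<longlonglongrightarrow> 0"
    by (simp add: nn_integral_count_space_nat)
  then have "(\<lambda>n. inverse c * (\<Sum>j. ennreal (w j) * b j n)) \<longlonglongrightarrow> inverse c * 0"
    using c0 by (intro ennreal_tendsto_cmult) (auto simp: less_top[symmetric])
  then have upper: "(\<lambda>n. inverse c * (\<Sum>j. ennreal (w j) * b j n)) \<longlonglongrightarrow> 0"
    by (simp only: mult_zero_right)
  have "(\<lambda>n. SUP X\<in>\<X>. \<integral>\<^sup>+x. T X n x \<partial>Q) \<longlonglongrightarrow> 0"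
    by (rule tendsto_sandwich[OF always_eventually always_eventually tendsto_const upper])
      (intro allI zero_le le)+
  then have "unif_integrable Q \<X>" by (simp add: unif_integrable_def T_def)
  with Q show ?thesis by blast
qed

end

section \<open>From uniform integrability to a trivial intersection\<close>

lemma equiv_prob_AE_iff:
  assumes "equiv_prob M Q"
  shows "(AE x in Q. P x) \<longleftrightarrow> (AE x in M. P x)"
proof -
  have "null_sets Q = null_sets M" "space Q = space M"
    using assms by (auto simp: equiv_prob_def null_sets_def)
  then show ?thesis by (simp add: eventually_ae_filter)
qed

text \<open>Pointwise, the excess over n is at most the value restricted to where it exceeds n;
  averaging over a convex combination cannot exceed the supremum.\<close>

lemma nn_integral_conv_shift_le:
  assumes Z: "Z \<in> conv_shift \<X> n" and X: "\<X> \<subseteq> borel_measurable Q"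
  shows "(\<integral>\<^sup>+x. ennreal (Z x) \<partial>Q)
    \<le> (SUP X\<in>\<X>. \<integral>\<^sup>+x. ennreal (X x * indicator {x. X x > real n} x) \<partial>Q)" (is "_ \<le> ?S")
proof -
  obtain k c F where F: "\<forall>i<k. 0 \<le> c i" "(\<Sum>i<k. c i) = 1" "\<forall>i<k. F i \<in> \<X>"
    and Z: "Z = (\<lambda>x. \<Sum>i<(k::nat). c i * max (F i x - real n) 0)"
    using assms(1) by (auto simp: conv_shift_def)
  have F_meas[measurable]: "F i \<in> borel_measurable Q" if "i < k" for i using F X that by blast
  have "(\<integral>\<^sup>+x. ennreal (Z x) \<partial>Q) = (\<integral>\<^sup>+x. (\<Sum>i<k. ennreal (c i) * ennreal (max (F i x - real n) 0)) \<partial>Q)"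
    unfolding Z using F(1)
    by (intro nn_integral_cong, subst sum_ennreal[symmetric]) (auto intro!: sum.cong simp: ennreal_mult)
  also have "\<dots> = (\<Sum>i<k. \<integral>\<^sup>+x. ennreal (c i) * ennreal (max (F i x - real n) 0) \<partial>Q)"
    by (rule nn_integral_sum) auto
  also have "\<dots> = (\<Sum>i<k. ennreal (c i) * (\<integral>\<^sup>+x. ennreal (max (F i x - real n) 0) \<partial>Q))"
    by (intro sum.cong refl nn_integral_cmult) auto
  also have "\<dots> \<le> (\<Sum>i<k. ennreal (c i) * ?S)"
  proof (intro sum_mono mult_left_mono)
    fix i assume "i \<in> {..<k}"
    then have "F i \<in> \<X>" using F by simp
    have "(\<integral>\<^sup>+x. ennreal (max (F i x - real n) 0) \<partial>Q)
        \<le> (\<integral>\<^sup>+x. ennreal (F i x * indicator {x. F i x > real n} x) \<partial>Q)"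
      by (intro nn_integral_mono ennreal_leI) (auto simp: indicator_def)
    also have "\<dots> \<le> ?S" using \<open>F i \<in> \<X>\<close> by (intro SUP_upper)
    finally show "(\<integral>\<^sup>+x. ennreal (max (F i x - real n) 0) \<partial>Q) \<le> ?S" .
  qed simp
  also have "\<dots> = ennreal (\<Sum>i<k. c i) * ?S"
    using F(1) by (subst sum_ennreal[symmetric]) (auto simp only: sum_distrib_right lessThan_iff)
  finally show ?thesis using F(2) by simp
qed

text \<open>For every n the Q-expectation of \<open>Y\<close> is below the uniform tail at n, hence
  0. Equivalence carries the resulting null set back to \<open>M\<close>.\<close>

lemma unif_integrable_imp_AE_zero:
  assumes Q: "equiv_prob M Q" "unif_integrable Q \<X>" and X: "\<X> \<subseteq> borel_measurable M"
    and Y: "\<And>n. Y \<in> O_set M \<X> n"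
  shows "AE x in M. Y x = 0"
proof -
  have sets: "sets Q = sets M" using Q by (simp add: equiv_prob_def)
  then have meas_eq: "borel_measurable Q = (borel_measurable M :: ('a \<Rightarrow> real) set)"
    by (rule measurable_cong_sets) simp
  have Y0: "Y \<in> borel_measurable M" "AE x in M. 0 \<le> Y x"
    using Y[of 0] by (auto simp: O_set_def L0_plus_def)
  have "(\<integral>\<^sup>+x. ennreal (Y x) \<partial>Q)
      \<le> (SUP X\<in>\<X>. \<integral>\<^sup>+x. ennreal (X x * indicator {x. X x > real n} x) \<partial>Q)" for n
  proof -
    obtain Z where Z: "Z \<in> conv_shift \<X> n" "AE x in M. Y x \<le> Z x"
      using Y[of n] by (auto simp: O_set_def)
    have "(\<integral>\<^sup>+x. ennreal (Y x) \<partial>Q) \<le> (\<integral>\<^sup>+x. ennreal (Z x) \<partial>Q)"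
      using Z(2) unfolding equiv_prob_AE_iff[OF Q(1), symmetric]
      by (intro nn_integral_mono_AE) (auto elim!: eventually_mono intro: ennreal_leI)
    also note nn_integral_conv_shift_le[OF Z(1)]
    finally show ?thesis using X by (simp add: meas_eq)
  qed
  then have "(\<integral>\<^sup>+x. ennreal (Y x) \<partial>Q) \<le> 0"
    using Q(2) unfolding unif_integrable_def by (intro LIMSEQ_le_const) auto
  then have "AE x in Q. ennreal (Y x) = 0"
    using measurable_compose[OF Y0(1) measurable_ennreal]
    by (subst nn_integral_0_iff_AE[symmetric]) (auto simp: measurable_cong_sets[OF sets refl])
  then have "AE x in M. ennreal (Y x) = 0" unfolding equiv_prob_AE_iff[OF Q(1)] .
  with Y0(2) show ?thesis by eventually_elim (simp add: ennreal_eq_0_iff)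
qed

theorem theorem2p2:
  fixes M :: "'a measure" and \<X> :: "('a \<Rightarrow> real) set"
  assumes "prob_space M"
    and "\<X> \<subseteq> L0_plus M"
    and "\<X> \<noteq> {}"
  shows "((\<forall>Y. (\<forall>n. Y \<in> O_set M \<X> n) \<longrightarrow> (AE \<omega> in M. Y \<omega> = 0))
          \<and> (\<forall>n. (\<lambda>\<omega>. 0) \<in> O_set M \<X> n))
         \<longleftrightarrow> (\<exists>Q. equiv_prob M Q \<and> unif_integrable Q \<X>)"
proof -
  have X: "\<X> \<subseteq> borel_measurable M" using assms(2) by (auto simp: L0_plus_def)
  \<comment> \<open>Nonemptiness of \<X> enters here: some element of the hull is required to
    dominate 0.\<close>
  have "(\<lambda>\<omega>. 0) \<in> O_set M \<X> n" for n
  proof -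
    obtain X where "X \<in> \<X>" using assms(3) by blast
    then show ?thesis
      unfolding O_set_def L0_plus_def by (auto intro!: bexI[OF _ conv_shift_single])
  qed
  then show ?thesis
    using prob_space.exists_unif_integrable[OF assms(1) X assms(3)]
      unif_integrable_imp_AE_zero[OF _ _ X] by blast
qed

end
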